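(* Let $H$ be a complex Hilbert space, let $A\in\mathcal{B}(H)$ and $B\in\mathcal{B}(\ell^2)$ be positive, and let $F=\{f_n\}_{n\in\mathbb{N}}$ be a Bessel sequence in $H$. Then the reduced weighted adjoints of $C_{AB}$, $D_{AB}$ and $S_{AB}$ exist and satisfy $C_{AB}^{\#}=P_AD_{AB}$, $D_{AB}^{\#}=P_BC_{AB}$ and $S_{AB}^{\#}=P_AS_{AB}$.
   Context: $\ell^2=\ell^2(\mathbb{N})$ is the complex Hilbert space of square-summable sequences; inner products are linear in the first variable; $\langle f,g\rangle_A=\langle Af,g\rangle$ on $H$. $\mathcal{D}$, $\mathcal{R}$ denote domain and range, $T^*$ the Hilbert-space adjoint; $P_A$ and $P_B$ are the orthogonal projections onto $\overline{\mathcal{R}(A)}$ and $\overline{\mathcal{R}(B)}$. $F$ is a Bessel sequence if there is $b>0$ with $\sum_{n=1}^\infty|\langle f,f_n\rangle|^2\le b\|f\|^2$ for all $f\in H$. Operators associated with $F$: $D_Fc=\sum_{n=1}^\infty c_nf_n$ with $\mathcal{D}(D_F)=\{c\in\ell^2:\sum_{n=1}^\infty c_nf_n\text{ converges in }H\}$; $C_{AB}f=\{\langle f,f_n\rangle_A\}_n$ with $\mathcal{D}(C_{AB})=\{f\in H:\{\langle f,f_n\rangle_A\}_n\in\ell^2\}$; $D_{AB}=D_FB$ with $\mathcal{D}(D_{AB})=\{c\in\ell^2:Bc\in\mathcal{D}(D_F)\}$; $S_{AB}=D_{AB}C_{AB}$ with $\mathcal{D}(S_{AB})=\{f\in\mathcal{D}(C_{AB}):C_{AB}f\in\mathcal{D}(D_{AB})\}$.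 Reduced weighted adjoints: for $T:H\to\ell^2$, $T^{\#}:\ell^2\to H$ is the unique operator with $T^*B=AT^{\#}$ and $\mathcal{R}(T^{\#})\subseteq\overline{\mathcal{R}(A)}$ (existing when $\mathcal{R}(T^*B)\subseteq\mathcal{R}(A)$); for $R:\ell^2\to H$, $R^{\#}:H\to\ell^2$ is the unique operator with $R^*A=BR^{\#}$ and $\mathcal{R}(R^{\#})\subseteq\overline{\mathcal{R}(B)}$ (existing when $\mathcal{R}(R^*A)\subseteq\mathcal{R}(B)$); for $S:H\to H$, the $A$-adjoint $S^{\#}$ is the unique operator on $H$ with $S^*A=AS^{\#}$ and $\mathcal{R}(S^{\#})\subseteq\overline{\mathcal{R}(A)}$ (existing when $\mathcal{R}(S^*A)\subseteq\mathcal{R}(A)$). *)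

theory Defs
  imports "HOL-Analysis.Analysis"
begin

section \<open>Complex Hilbert spaces\<close>

class complex_vector = real_vector +
  fixes scaleC :: "complex \<Rightarrow> 'a \<Rightarrow> 'a"  (infixr "*\<^sub>C" 75)
  assumes scaleR_scaleC: "r *\<^sub>R x = complex_of_real r *\<^sub>C x"
    and scaleC_add_right: "a *\<^sub>C (x + y) = a *\<^sub>C x + a *\<^sub>C y"
    and scaleC_add_left: "(a + b) *\<^sub>C x = a *\<^sub>C x + b *\<^sub>C x"
    and scaleC_scaleC: "a *\<^sub>C b *\<^sub>C x = (a * b) *\<^sub>C x"
    and scaleC_one: "1 *\<^sub>C x = x"

text \<open>
  The complex inner product is linear in its first argument. Positive definiteness, the norm
  and the topology come from \<^class>\<open>real_inner\<close>, whose inner product is the real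
  part of the complex one.
\<close>

class complex_inner = complex_vector + real_inner +
  fixes cinner :: "'a \<Rightarrow> 'a \<Rightarrow> complex"
  assumes cinner_commute: "cinner x y = cnj (cinner y x)"
    and cinner_add_left: "cinner (x + y) z = cinner x z + cinner y z"
    and cinner_scaleC_left: "cinner (a *\<^sub>C x) y = a * cinner x y"
    and inner_eq_Re_cinner: "inner x y = Re (cinner x y)"

class chilbert_space = complex_inner + complete_space


section \<open>The space of square-summable sequences\<close>

definition square_summable :: "(nat \<Rightarrow> complex) \<Rightarrow> bool" where
  "square_summable c \<longleftrightarrow> summable (\<lambda>n. (cmod (c n))\<^sup>2)"

lemma square_summable_zero: "square_summable (\<lambda>n. 0)"
  by (simp add: square_summable_def)

lemma square_summable_scale:
  assumes "square_summable c" shows "square_summable (\<lambda>n. a * c n)"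
  using assms by (simp add: square_summable_def norm_mult power_mult_distrib summable_mult)

lemma square_summable_add:
  assumes "square_summable c" "square_summable d" shows "square_summable (\<lambda>n. c n + d n)"
proof -
  have le: "(cmod (c n + d n))\<^sup>2 \<le> 2 * (cmod (c n))\<^sup>2 + 2 * (cmod (d n))\<^sup>2" for n
  proof -
    have "(cmod (c n + d n))\<^sup>2 \<le> (cmod (c n) + cmod (d n))\<^sup>2"
      by (simp add: norm_triangle_ineq power_mono)
    also have "\<dots> \<le> 2 * (cmod (c n))\<^sup>2 + 2 * (cmod (d n))\<^sup>2"
      using sum_squares_bound[of "cmod (c n)" "cmod (d n)"] by (simp add: power2_sum)
    finally show ?thesis .
  qed
  have "summable (\<lambda>n. 2 * (cmod (c n))\<^sup>2 + 2 * (cmod (d n))\<^sup>2)"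
    using assms by (intro summable_add summable_mult) (auto simp: square_summable_def)
  then show ?thesis
    unfolding square_summable_def by (rule summable_comparison_test') (simp add: le)
qed

lemma summable_prod_cnj:
  assumes "square_summable c" "square_summable d" shows "summable (\<lambda>n. c n * cnj (d n))"
proof -
  have "summable (\<lambda>n. (cmod (c n))\<^sup>2 + (cmod (d n))\<^sup>2)"
    using assms by (intro summable_add) (auto simp: square_summable_def)
  then show ?thesis
  proof (rule summable_comparison_test')
    show "norm (c n * cnj (d n)) \<le> (cmod (c n))\<^sup>2 + (cmod (d n))\<^sup>2" for n
    proof -
      have "0 \<le> cmod (c n) * cmod (d n)" by simp
      then show ?thesis
        using sum_squares_bound[of "cmod (c n)" "cmod (d n)"] by (simp only: norm_mult complex_mod_cnj)
    qed
  qed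
qed

lemma suminf_mult_cnj_self:
  assumes "square_summable c"
  shows "(\<Sum>n. c n * cnj (c n)) = complex_of_real (\<Sum>n. (cmod (c n))\<^sup>2)"
proof -
  have "(\<Sum>n. c n * cnj (c n)) = (\<Sum>n. complex_of_real ((cmod (c n))\<^sup>2))"
    by (simp only: complex_norm_square)
  also have "\<dots> = complex_of_real (\<Sum>n. (cmod (c n))\<^sup>2)"
    using assms unfolding square_summable_def by (rule suminf_of_real[symmetric])
  finally show ?thesis .
qed

typedef ell2 = "{c :: nat \<Rightarrow> complex. square_summable c}"
  using square_summable_zero by blast

setup_lifting type_definition_ell2

instantiation ell2 :: ab_group_add
begin
lift_definition zero_ell2 :: ell2 is "\<lambda>n. 0"
  by (rule square_summable_zero)
lift_definition plus_ell2 :: "ell2 \<Rightarrow> ell2 \<Rightarrow> ell2" is "\<lambda>c d n. c n + d n"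
  by (rule square_summable_add)
lift_definition uminus_ell2 :: "ell2 \<Rightarrow> ell2" is "\<lambda>c n. - c n"
  by (simp add: square_summable_def)
lift_definition minus_ell2 :: "ell2 \<Rightarrow> ell2 \<Rightarrow> ell2" is "\<lambda>c d n. c n - d n"
proof -
  fix c d :: "nat \<Rightarrow> complex" assume "square_summable c" "square_summable d"
  then show "square_summable (\<lambda>n. c n - d n)"
    using square_summable_add[of c "\<lambda>n. - 1 * d n"] square_summable_scale[of d "- 1"] by simp
qed
instance
proof
  fix c d e :: ell2
  show "c + d + e = c + (d + e)" by transfer (simp add: add.assoc)
  show "c + d = d + c" by transfer (simp add: add.commute)
  show "0 + c = c" by transfer simp
  show "- c + c = 0" by transfer simp
  show "c - d = c + - d" by transfer simp
qed
end

instantiation ell2 :: complex_vector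
begin
lift_definition scaleC_ell2 :: "complex \<Rightarrow> ell2 \<Rightarrow> ell2" is "\<lambda>a c n. a * c n"
  by (rule square_summable_scale)
definition scaleR_ell2 :: "real \<Rightarrow> ell2 \<Rightarrow> ell2" where
  "scaleR_ell2 r c = complex_of_real r *\<^sub>C c"
instance
proof
  fix c d :: ell2 and a b :: complex and r q :: real
  show "r *\<^sub>R c = complex_of_real r *\<^sub>C c" by (rule scaleR_ell2_def)
  show add_right: "a *\<^sub>C (c + d) = a *\<^sub>C c + a *\<^sub>C d" for a
    by transfer (simp add: distrib_left)
  show add_left: "(a + b) *\<^sub>C c = a *\<^sub>C c + b *\<^sub>C c" for a b
    by transfer (simp add: distrib_right)
  show mult: "a *\<^sub>C b *\<^sub>C c = (a * b) *\<^sub>C c" for a b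
    by transfer (simp add: mult.assoc)
  show one: "1 *\<^sub>C c = c" by transfer simp
  show "r *\<^sub>R (c + d) = r *\<^sub>R c + r *\<^sub>R d"
    by (simp only: scaleR_ell2_def add_right)
  show "(r + q) *\<^sub>R c = r *\<^sub>R c + q *\<^sub>R c"
    by (simp only: scaleR_ell2_def of_real_add add_left)
  show "r *\<^sub>R q *\<^sub>R c = (r * q) *\<^sub>R c"
    by (simp only: scaleR_ell2_def of_real_mult mult)
  show "1 *\<^sub>R c = c"
    by (simp only: scaleR_ell2_def of_real_1 one)
qed
end

instantiation ell2 :: complex_inner
begin
lift_definition cinner_ell2 :: "ell2 \<Rightarrow> ell2 \<Rightarrow> complex" is "\<lambda>c d. \<Sum>n. c n * cnj (d n)" .
definition inner_ell2 :: "ell2 \<Rightarrow> ell2 \<Rightarrow> real" where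
  "inner_ell2 c d = Re (cinner c d)"
definition norm_ell2 :: "ell2 \<Rightarrow> real" where
  "norm_ell2 c = sqrt (inner c c)"
definition sgn_ell2 :: "ell2 \<Rightarrow> ell2" where
  "sgn_ell2 c = c /\<^sub>R norm c"
definition dist_ell2 :: "ell2 \<Rightarrow> ell2 \<Rightarrow> real" where
  "dist_ell2 c d = norm (c - d)"
definition uniformity_ell2 :: "(ell2 \<times> ell2) filter" where
  "uniformity_ell2 = (INF e\<in>{0 <..}. principal {(c, d). dist c d < e})"
definition open_ell2 :: "ell2 set \<Rightarrow> bool" where
  "open_ell2 U \<longleftrightarrow> (\<forall>c\<in>U. eventually (\<lambda>(c', d). c' = c \<longrightarrow> d \<in> U) uniformity)"
instance
proof
  fix c d e :: ell2 and a :: complex and r :: real and U :: "ell2 set"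
  show "sgn c = c /\<^sub>R norm c" by (rule sgn_ell2_def)
  show "dist c d = norm (c - d)" by (rule dist_ell2_def)
  show "uniformity = (INF e\<in>{0 <..}. principal {(c :: ell2, d). dist c d < e})"
    by (rule uniformity_ell2_def)
  show "open U \<longleftrightarrow> (\<forall>c\<in>U. eventually (\<lambda>(c', d). c' = c \<longrightarrow> d \<in> U) uniformity)"
    by (rule open_ell2_def)
  show norm: "norm c = sqrt (inner c c)" by (rule norm_ell2_def)
  show re: "inner c d = Re (cinner c d)" for c d :: ell2 by (rule inner_ell2_def)
  show com: "cinner c d = cnj (cinner d c)" for c d :: ell2
    by transfer (simp add: bounded_linear.suminf[OF bounded_linear_cnj] summable_prod_cnj mult.commute)
  show add: "cinner (c + d) e = cinner c e + cinner d e"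
    by transfer (simp add: distrib_right suminf_add summable_prod_cnj)
  show sc: "cinner (a *\<^sub>C c) d = a * cinner c d" for a
    by transfer (simp add: suminf_mult summable_prod_cnj mult.assoc)
  show "inner c d = inner d c" by (metis re com cnj.simps(1))
  show "inner (c + d) e = inner c e + inner d e" by (simp add: re add)
  show "inner (r *\<^sub>R c) d = r * inner c d" by (simp add: re scaleR_ell2_def sc)
  have *: "cinner c c = complex_of_real (\<Sum>n. (cmod (Rep_ell2 c n))\<^sup>2)"
    using Rep_ell2[of c]
    by (simp only: cinner_ell2.rep_eq suminf_mult_cnj_self mem_Collect_eq)
  show "0 \<le> inner c c"
    using Rep_ell2[of c] unfolding re * by (simp add: suminf_nonneg square_summable_def)
  have "inner c c = 0 \<longleftrightarrow> (\<forall>n. (cmod (Rep_ell2 c n))\<^sup>2 = 0)"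
    using Rep_ell2[of c] unfolding re * Re_complex_of_real
    by (intro suminf_eq_zero_iff) (simp_all add: square_summable_def)
  also have "\<dots> \<longleftrightarrow> Rep_ell2 c = Rep_ell2 0"
    by (simp add: zero_ell2.rep_eq fun_eq_iff)
  finally show "inner c c = 0 \<longleftrightarrow> c = 0"
    by (simp only: Rep_ell2_inject)
qed
end

lemma norm_ell2_sq: "(norm c)\<^sup>2 = (\<Sum>n. (cmod (Rep_ell2 c n))\<^sup>2)"
proof -
  have "cinner c c = complex_of_real (\<Sum>n. (cmod (Rep_ell2 c n))\<^sup>2)"
    using Rep_ell2[of c]
    by (simp only: cinner_ell2.rep_eq suminf_mult_cnj_self mem_Collect_eq)
  then show ?thesis by (simp add: power2_norm_eq_inner inner_eq_Re_cinner)
qed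

lemma sum_le_norm_ell2_sq: "(\<Sum>n<N. (cmod (Rep_ell2 c n))\<^sup>2) \<le> (norm c)\<^sup>2"
  unfolding norm_ell2_sq using Rep_ell2[of c] by (intro sum_le_suminf) (auto simp: square_summable_def)

lemma cmod_Rep_ell2_le: "cmod (Rep_ell2 c n) \<le> norm c"
proof (rule power2_le_imp_le)
  have "(cmod (Rep_ell2 c n))\<^sup>2 \<le> (\<Sum>n<Suc n. (cmod (Rep_ell2 c n))\<^sup>2)"
    by (simp add: sum_nonneg)
  then show "(cmod (Rep_ell2 c n))\<^sup>2 \<le> (norm c)\<^sup>2"
    using sum_le_norm_ell2_sq[where N="Suc n" and c=c] by linarith
qed simp

instance ell2 :: chilbert_space
proof
  fix X :: "nat \<Rightarrow> ell2" assume "Cauchy X"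
  define x where "x k n = Rep_ell2 (X k) n" for k n
  have diff: "Rep_ell2 (X k - X m) n = x k n - x m n" for k m n
    by (simp add: x_def minus_ell2.rep_eq)
  have "Cauchy (\<lambda>k. x k n)" for n
  proof (rule metric_CauchyI)
    fix e :: real assume "e > 0"
    then obtain M where M: "\<And>k m. k \<ge> M \<Longrightarrow> m \<ge> M \<Longrightarrow> dist (X k) (X m) < e"
      using metric_CauchyD[OF \<open>Cauchy X\<close> \<open>e > 0\<close>] by blast
    have "dist (x k n) (x m n) < e" if "k \<ge> M" "m \<ge> M" for k m
      using M[OF that] cmod_Rep_ell2_le[of "X k - X m" n] by (simp add: dist_norm diff)
    then show "\<exists>M. \<forall>k\<ge>M. \<forall>m\<ge>M. dist (x k n) (x m n) < e" by blast
  qed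
  then have "\<exists>l. (\<lambda>k. x k n) \<longlonglongrightarrow> l" for n
    by (simp add: Cauchy_convergent_iff convergent_def)
  then obtain l where l: "\<And>n. (\<lambda>k. x k n) \<longlonglongrightarrow> l n" by metis
  have tail: "\<exists>M. \<forall>k\<ge>M. square_summable (\<lambda>n. x k n - l n) \<and>
      (\<Sum>n. (cmod (x k n - l n))\<^sup>2) \<le> e\<^sup>2" if "e > 0" for e :: real
  proof -
    obtain M where M: "\<And>k m. k \<ge> M \<Longrightarrow> m \<ge> M \<Longrightarrow> dist (X k) (X m) < e"
      using metric_CauchyD[OF \<open>Cauchy X\<close> \<open>e > 0\<close>] by blast
    have "square_summable (\<lambda>n. x k n - l n) \<and> (\<Sum>n. (cmod (x k n - l n))\<^sup>2) \<le> e\<^sup>2"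
      if k: "k \<ge> M" for k
    proof -
      have bd: "(\<Sum>n<N. (cmod (x k n - l n))\<^sup>2) \<le> e\<^sup>2" for N
      proof (rule LIMSEQ_le_const2)
        show "(\<lambda>m. \<Sum>n<N. (cmod (x k n - x m n))\<^sup>2) \<longlonglongrightarrow> (\<Sum>n<N. (cmod (x k n - l n))\<^sup>2)"
          by (intro tendsto_intros l)
        have "(\<Sum>n<N. (cmod (x k n - x m n))\<^sup>2) \<le> e\<^sup>2" if "m \<ge> M" for m
        proof -
          have "(norm (X k - X m))\<^sup>2 \<le> e\<^sup>2"
            using M[OF k that] by (intro power_mono) (auto simp: dist_norm)
          then show ?thesis
            using sum_le_norm_ell2_sq[of "X k - X m" N] by (simp add: diff)
        qed
        then show "\<exists>M. \<forall>m\<ge>M. (\<Sum>n<N. (cmod (x k n - x m n))\<^sup>2) \<le> e\<^sup>2" by blast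
      qed
      have "summable (\<lambda>n. (cmod (x k n - l n))\<^sup>2)"
        by (rule summableI_nonneg_bounded[of _ "e\<^sup>2"]) (auto simp: bd)
      then show ?thesis
        by (auto simp: square_summable_def intro!: suminf_le_const bd)
    qed
    then show ?thesis by blast
  qed
  obtain K where K: "square_summable (\<lambda>n. x K n - l n)"
    using tail[of 1] by auto
  have "square_summable (x K)" using Rep_ell2[of "X K"] by (simp add: x_def[abs_def])
  then have "square_summable l"
    using square_summable_add[OF _ square_summable_scale[OF K, of "- 1"]] by fastforce
  then have Rep: "Rep_ell2 (Abs_ell2 l) = l" by (simp add: Abs_ell2_inverse)
  have "X \<longlonglongrightarrow> Abs_ell2 l"
  proof (rule metric_LIMSEQ_I)
    fix e :: real assume e: "e > 0"
    then obtain M where M: "\<And>k. k \<ge> M \<Longrightarrow> (\<Sum>n. (cmod (x k n - l n))\<^sup>2) \<le> (e/2)\<^sup>2"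
      using tail[of "e/2"] by auto
    have "dist (X k) (Abs_ell2 l) < e" if "k \<ge> M" for k
    proof -
      have "(norm (X k - Abs_ell2 l))\<^sup>2 \<le> (e/2)\<^sup>2"
        using M[OF that] by (simp add: norm_ell2_sq minus_ell2.rep_eq Rep x_def)
      then have "norm (X k - Abs_ell2 l) \<le> e/2"
        by (rule power2_le_imp_le) (use e in simp)
      then show ?thesis using e by (simp add: dist_norm)
    qed
    then show "\<exists>M. \<forall>k\<ge>M. dist (X k) (Abs_ell2 l) < e" by blast
  qed
  then show "convergent X" by (auto simp: convergent_def)
qed


section \<open>Operators\<close>

text \<open>
  A possibly unbounded operator is a partial function \<open>T :: 'a \<rightharpoonup> 'b\<close> with
  domain \<^term>\<open>dom T\<close> and range \<^term>\<open>ran T\<close>. Composition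
  \<open>S \<circ>\<^sub>m T\<close> then has the natural domain of all \<open>x \<in> dom T\<close> with
  \<open>T x \<in> dom S\<close>, and equality of operators includes equality of domains.
  Everywhere defined operators are also written as total functions and embedded by \<open>total_op\<close>.
\<close>

definition total_op :: "('a \<Rightarrow> 'b) \<Rightarrow> ('a \<rightharpoonup> 'b)" where
  "total_op f = (\<lambda>x. Some (f x))"

definition linear_op :: "('a::complex_vector \<rightharpoonup> 'b::complex_vector) \<Rightarrow> bool" where
  "linear_op T \<longleftrightarrow> T 0 = Some 0 \<and>
     (\<forall>x y u v. T x = Some u \<and> T y = Some v \<longrightarrow> T (x + y) = Some (u + v)) \<and>
     (\<forall>a x u. T x = Some u \<longrightarrow> T (a *\<^sub>C x) = Some (a *\<^sub>C u))"

definition bounded_clinear :: "('a::complex_inner \<Rightarrow> 'b::complex_inner) \<Rightarrow> bool" where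
  "bounded_clinear f \<longleftrightarrow> bounded_linear f \<and> (\<forall>a x. f (a *\<^sub>C x) = a *\<^sub>C f x)"

definition positive_op :: "('a::complex_inner \<Rightarrow> 'a) \<Rightarrow> bool" where
  "positive_op A \<longleftrightarrow> (\<forall>x. cinner (A x) x \<in> \<real>\<^sub>\<ge>\<^sub>0)"

definition bounded_op :: "('a::complex_inner \<rightharpoonup> 'b::complex_inner) \<Rightarrow> bool" where
  "bounded_op T \<longleftrightarrow> (\<exists>f. bounded_clinear f \<and> T = total_op f)"

text \<open>Meaningful for densely defined \<open>T\<close>, where the vector \<open>z\<close> below is unique.\<close>

definition adjoint_op :: "('a::complex_inner \<rightharpoonup> 'b::complex_inner) \<Rightarrow> ('b \<rightharpoonup> 'a)" where
  "adjoint_op T = (\<lambda>y.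
     if \<exists>z. \<forall>x\<in>dom T. cinner (the (T x)) y = cinner x z
     then Some (THE z. \<forall>x\<in>dom T. cinner (the (T x)) y = cinner x z)
     else None)"

definition orth_proj :: "'a::complex_inner set \<Rightarrow> 'a \<Rightarrow> 'a" where
  "orth_proj M x = (THE y. y \<in> M \<and> (\<forall>z\<in>M. cinner (x - y) z = 0))"

abbreviation range_proj :: "('a::complex_inner \<Rightarrow> 'a) \<Rightarrow> 'a \<Rightarrow> 'a" where
  "range_proj A \<equiv> orth_proj (closure (range A))"

text \<open>
  \<open>X\<close> is the reduced weighted adjoint of \<open>T : K\<^sub>1 \<rightarrow> K\<^sub>2\<close> with
  respect to the weights \<open>W\<^sub>1\<close> on \<open>K\<^sub>1\<close> and \<open>W\<^sub>2\<close>
  on \<open>K\<^sub>2\<close>, i.e. the solution of \<open>T\<^sup>* W\<^sub>2 = W\<^sub>1 X\<close> with range in the closure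
  of the range of \<open>W\<^sub>1\<close>. The three kinds of reduced weighted adjoint are the
  instances \<open>(W\<^sub>1, W\<^sub>2) = (A, B), (B, A), (A, A)\<close>.
\<close>

definition is_reduced_adjoint ::
  "('a::complex_inner \<Rightarrow> 'a) \<Rightarrow> ('b::complex_inner \<Rightarrow> 'b) \<Rightarrow> ('a \<rightharpoonup> 'b) \<Rightarrow> ('b \<rightharpoonup> 'a) \<Rightarrow> bool" where
  "is_reduced_adjoint W1 W2 T X \<longleftrightarrow>
     linear_op T \<and> closure (dom T) = UNIV \<and> linear_op X \<and>
     adjoint_op T \<circ>\<^sub>m total_op W2 = total_op W1 \<circ>\<^sub>m X \<and>
     ran X \<subseteq> closure (range W1)"

definition reduced_adjoint ::
  "('a::complex_inner \<Rightarrow> 'a) \<Rightarrow> ('b::complex_inner \<Rightarrow> 'b) \<Rightarrow> ('a \<rightharpoonup> 'b) \<Rightarrow> ('b \<rightharpoonup> 'a)" where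
  "reduced_adjoint W1 W2 T = (THE X. is_reduced_adjoint W1 W2 T X)"


section \<open>Operators associated with a sequence\<close>

text \<open>Sequences are indexed from \<open>0\<close>.\<close>

definition bessel :: "(nat \<Rightarrow> 'h::complex_inner) \<Rightarrow> bool" where
  "bessel F \<longleftrightarrow> (\<exists>b>0. \<forall>f. summable (\<lambda>n. (cmod (cinner f (F n)))\<^sup>2) \<and>
     (\<Sum>n. (cmod (cinner f (F n)))\<^sup>2) \<le> b * (norm f)\<^sup>2)"

definition weighted_cinner :: "('h::complex_inner \<Rightarrow> 'h) \<Rightarrow> 'h \<Rightarrow> 'h \<Rightarrow> complex" where
  "weighted_cinner A f g = cinner (A f) g"

definition D_F :: "(nat \<Rightarrow> 'h::complex_inner) \<Rightarrow> (ell2 \<rightharpoonup> 'h)" where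
  "D_F F = (\<lambda>c. if summable (\<lambda>n. Rep_ell2 c n *\<^sub>C F n)
     then Some (\<Sum>n. Rep_ell2 c n *\<^sub>C F n) else None)"

text \<open>\<open>C_AB\<close> depends on \<open>A\<close> only and \<open>D_AB\<close> on \<open>B\<close> only.\<close>

definition C_AB :: "('h::complex_inner \<Rightarrow> 'h) \<Rightarrow> (nat \<Rightarrow> 'h) \<Rightarrow> ('h \<rightharpoonup> ell2)" where
  "C_AB A F = (\<lambda>f. if square_summable (\<lambda>n. weighted_cinner A f (F n))
     then Some (Abs_ell2 (\<lambda>n. weighted_cinner A f (F n))) else None)"

definition D_AB :: "(ell2 \<Rightarrow> ell2) \<Rightarrow> (nat \<Rightarrow> 'h::complex_inner) \<Rightarrow> (ell2 \<rightharpoonup> 'h)" where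
  "D_AB B F = D_F F \<circ>\<^sub>m total_op B"

definition S_AB ::
  "('h::complex_inner \<Rightarrow> 'h) \<Rightarrow> (ell2 \<Rightarrow> ell2) \<Rightarrow> (nat \<Rightarrow> 'h) \<Rightarrow> ('h \<rightharpoonup> 'h)" where
  "S_AB A B F = D_AB B F \<circ>\<^sub>m C_AB A F"

end

theory Submission
  imports Defs
begin

text \<open>
  For a Bessel sequence \<open>F\<close> the analysis operator \<open>C f = (\<langle>f, f\<^sub>n\<rangle>)\<^sub>n\<close> and the synthesis operator
  \<open>D c = \<Sum>n. c\<^sub>n f\<^sub>n\<close> are bounded, everywhere defined and adjoint to each other, so that
  \<open>C_AB = C A\<close>, \<open>D_AB = D B\<close> and \<open>S_AB = D B C A\<close>. As \<open>A\<close> and \<open>B\<close> are self-adjoint, the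
  adjoints are \<open>A D\<close>, \<open>B C\<close> and \<open>A D B C\<close>. In each case the right-hand side of the defining
  equation factors through the weight, \<open>T\<^sup>* W\<^sub>2 = W\<^sub>1 R\<close> with \<open>R = D B\<close>, \<open>C A\<close>, \<open>D B C A\<close>
  respectively. Since the kernel of \<open>W\<^sub>1\<close> is the orthogonal complement of its range, the
  solution with range in the closure of the range of \<open>W\<^sub>1\<close> is the projection of \<open>R\<close>.
\<close>

section \<open>Complex inner products\<close>

lemma cinner_scaleC_right: "cinner x (a *\<^sub>C y) = cnj a * cinner x y"
  by (metis cinner_commute cinner_scaleC_left complex_cnj_mult)

lemma cinner_add_right: "cinner x (y + z) = cinner x y + cinner x z"
  by (metis cinner_commute cinner_add_left complex_cnj_add)

lemma cinner_zero_left [simp]: "cinner 0 x = 0"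
  using cinner_add_left[of 0 0 x] by simp

lemma cinner_zero_right [simp]: "cinner x 0 = 0"
  using cinner_add_right[of x 0 0] by simp

lemma cinner_diff_left: "cinner (x - y) z = cinner x z - cinner y z"
  using cinner_add_left[of "x - y" y z] by simp

lemma cinner_self_eq_0_iff: "cinner x x = 0 \<longleftrightarrow> x = 0"
  by (metis cinner_zero_left inner_eq_Re_cinner inner_eq_zero_iff zero_complex.simps(1))

text \<open>The hypothesis at \<open>x = y - z\<close> makes the squared norm of
  \<open>y - z\<close> vanish. This is what makes the vector in \<open>adjoint_op\<close>
  unique.\<close>

lemma cinner_eqI:
  assumes "\<And>x. cinner x y = cinner x z" shows "y = z"
proof -
  have "cinner (y - z) (y - z) = cnj (cinner (y - z) y - cinner (y - z) z)"
    by (metis cinner_commute cinner_diff_left complex_cnj_diff)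
  then show ?thesis using assms by (simp add: cinner_self_eq_0_iff)
qed

text \<open>Conjugate linearity in the second argument turns the real part at
  \<open>\<i> *\<^sub>C y\<close> into the imaginary part at \<open>y\<close>. Continuity and
  orthogonality thus carry over from the real inner product.\<close>

lemma cinner_eq_inner: "cinner x y = Complex (inner x y) (inner x (\<i> *\<^sub>C y))"
  by (simp add: inner_eq_Re_cinner cinner_scaleC_right)

lemma bounded_linear_cinner_left: "bounded_linear (\<lambda>x. cinner x y)"
proof -
  have "bounded_linear (\<lambda>x. complex_of_real (inner x y) + \<i> * complex_of_real (inner x (\<i> *\<^sub>C y)))"
    by (intro bounded_linear_add bounded_linear_const_mult bounded_linear_compose[OF bounded_linear_of_real]
        bounded_linear_inner_left)
  then show ?thesis by (simp add: cinner_eq_inner Complex_eq)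
qed

lemma norm_scaleC: "norm (a *\<^sub>C x) = cmod a * norm (x::'a::complex_inner)"
proof -
  have "(norm (a *\<^sub>C x))\<^sup>2 = Re (a * cnj a * cinner x x)"
    by (simp add: power2_norm_eq_inner inner_eq_Re_cinner cinner_scaleC_left cinner_scaleC_right
        mult_ac)
  also have "\<dots> = (cmod a)\<^sup>2 * (norm x)\<^sup>2"
    by (simp add: complex_norm_square[symmetric] power2_norm_eq_inner inner_eq_Re_cinner
        flip: of_real_power)
  finally show ?thesis by (simp flip: power_mult_distrib)
qed

lemma bounded_linear_scaleC: "bounded_linear (\<lambda>x::'a::complex_inner. a *\<^sub>C x)"
  by (rule bounded_linear_intro[of _ "cmod a"])
    (simp_all add: scaleC_add_right scaleR_scaleC scaleC_scaleC norm_scaleC mult_ac)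

section \<open>Bounded complex-linear maps and self-adjointness of positive operators\<close>

lemma bounded_clinearI:
  assumes "\<And>x y. f (x + y) = f x + f y" and "\<And>a x. f (a *\<^sub>C x) = a *\<^sub>C f x"
    and "\<And>x. norm (f x) \<le> norm x * K"
  shows "bounded_clinear f"
  unfolding bounded_clinear_def using assms
  by (auto intro!: bounded_linear_intro[of _ K] simp: scaleR_scaleC)

lemma bounded_clinear_compose:
  "bounded_clinear f \<Longrightarrow> bounded_clinear g \<Longrightarrow> bounded_clinear (f \<circ> g)"
  by (auto simp: bounded_clinear_def comp_def intro: bounded_linear_compose)

lemma bounded_clinear_add: "bounded_clinear f \<Longrightarrow> f (x + y) = f x + f y"
  by (simp add: bounded_clinear_def linear_add bounded_linear.linear)

lemma bounded_clinear_scaleC: "bounded_clinear f \<Longrightarrow> f (a *\<^sub>C x) = a *\<^sub>C f x"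
  by (simp add: bounded_clinear_def)

text \<open>Polarization: the form \<open>cinner (A z) z\<close> is real. Expanding it at
  \<open>x + y\<close> compares the imaginary parts of \<open>cinner (A x) y\<close> and
  \<open>cinner (A y) x\<close>, and at \<open>x + \<i> *\<^sub>C y\<close> the real parts.\<close>

lemma positive_op_self_adjoint:
  assumes "bounded_clinear A" and "positive_op A"
  shows "cinner (A x) y = cinner x (A y)"
proof -
  have real: "Im (cinner (A z) z) = 0" for z
    using assms(2) by (simp add: positive_op_def complex_nonneg_Reals_iff)
  have "Im (cinner (A x) y) = - Im (cinner (A y) x)"
    using real[of "x + y"] real[of x] real[of y]
    by (simp add: bounded_clinear_add[OF assms(1)] cinner_add_left cinner_add_right)
  moreover have "Re (cinner (A x) y) = Re (cinner (A y) x)"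
    using real[of "x + \<i> *\<^sub>C y"] real[of x] real[of y]
    by (simp add: bounded_clinear_add[OF assms(1)] bounded_clinear_scaleC[OF assms(1)]
        cinner_add_left cinner_add_right cinner_scaleC_left cinner_scaleC_right)
  ultimately have "cinner (A x) y = cnj (cinner (A y) x)"
    by (simp add: complex_eq_iff)
  then show ?thesis by (metis cinner_commute)
qed


section \<open>Orthogonal projections\<close>

text \<open>A minimizing sequence for the distance from \<open>x\<close> to \<open>M\<close> is
  Cauchy; its limit exists by completeness and lies in \<open>M\<close> by closedness.\<close>

lemma subspace_nearest_point:
  fixes M :: "'a::{real_inner, complete_space} set"
  assumes "subspace M" and "closed M"
  obtains y where "y \<in> M" and "\<And>z. z \<in> M \<Longrightarrow> norm (x - y) \<le> norm (x - z)"
proof -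
  define d where "d = infdist x M"
  have ne: "M \<noteq> {}" using assms(1) subspace_0 by blast
  have d_le: "d \<le> norm (x - z)" if "z \<in> M" for z
    using infdist_le[OF that, of x] by (simp add: d_def dist_norm)
  have d0: "d \<ge> 0" by (simp add: d_def infdist_nonneg)
  have "\<exists>y\<in>M. norm (x - y) < d + inverse (Suc n)" for n
  proof -
    have "(INF a\<in>M. dist x a) < d + inverse (Suc n)"
      using ne by (simp add: d_def infdist_def)
    then show ?thesis
      using ne by (subst (asm) cINF_less_iff) (auto simp: dist_norm intro: bdd_belowI2[of _ 0])
  qed
  then obtain y where yM: "\<And>n. y n \<in> M" and y: "\<And>n. norm (x - y n) < d + inverse (Suc n)"
    by metis
  have lim: "(\<lambda>n. norm (x - y n)) \<longlonglongrightarrow> d"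
  proof (rule tendsto_sandwich[of "\<lambda>_. d" _ _ "\<lambda>n. d + inverse (Suc n)"])
    show "(\<lambda>n. d + inverse (real (Suc n))) \<longlonglongrightarrow> d"
      using tendsto_add[OF tendsto_const LIMSEQ_inverse_real_of_nat, of d] by simp
    show "\<forall>\<^sub>F n in sequentially. norm (x - y n) \<le> d + inverse (real (Suc n))"
      by (intro always_eventually allI less_imp_le y)
  qed (simp_all add: d_le yM)
  \<comment> \<open>The parallelogram law, with the midpoint of \<open>y m\<close> and \<open>y n\<close> at distance at least \<open>d\<close>.\<close>
  have par: "(norm (y m - y n))\<^sup>2 \<le> 2 * ((norm (x - y m))\<^sup>2 - d\<^sup>2) + 2 * ((norm (x - y n))\<^sup>2 - d\<^sup>2)" for m n
  proof -
    let ?z = "(1/2) *\<^sub>R (y m + y n)"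
    have "d\<^sup>2 \<le> (norm (x - ?z))\<^sup>2"
      by (intro power_mono d_le d0 subspace_scale subspace_add assms yM)
    moreover have "(norm (y m - y n))\<^sup>2 = 2 * (norm (x - y m))\<^sup>2 + 2 * (norm (x - y n))\<^sup>2 - 4 * (norm (x - ?z))\<^sup>2"
      by (simp add: power2_norm_eq_inner inner_diff_left inner_diff_right inner_add_left
          inner_add_right inner_commute algebra_simps)
    ultimately show ?thesis by (simp add: algebra_simps)
  qed
  have "Cauchy y"
  proof (rule metric_CauchyI)
    fix e :: real assume e: "e > 0"
    have "(\<lambda>n. (norm (x - y n))\<^sup>2 - d\<^sup>2) \<longlonglongrightarrow> d\<^sup>2 - d\<^sup>2"
      by (intro tendsto_intros lim)
    \<comment> \<open>Both excess terms in \<open>par\<close> carry the factor 2, so a quarter of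
      \<open>e\<^sup>2\<close> for each adds up to \<open>e\<^sup>2\<close>.\<close>
    then have "\<forall>\<^sub>F n in sequentially. (norm (x - y n))\<^sup>2 - d\<^sup>2 < e\<^sup>2 / 4"
      using e by (intro order_tendstoD) auto
    then obtain N where N: "\<And>n. n \<ge> N \<Longrightarrow> (norm (x - y n))\<^sup>2 - d\<^sup>2 < e\<^sup>2 / 4"
      by (auto simp: eventually_sequentially)
    have "dist (y m) (y n) < e" if "m \<ge> N" "n \<ge> N" for m n
    proof -
      have "(norm (y m - y n))\<^sup>2 < e\<^sup>2"
        using par[of m n] N[OF that(1)] N[OF that(2)] by argo
      then show ?thesis using e by (simp add: dist_norm power2_less_imp_less)
    qed
    then show "\<exists>N. \<forall>m\<ge>N. \<forall>n\<ge>N. dist (y m) (y n) < e" by blast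
  qed
  then obtain l where l: "y \<longlonglongrightarrow> l" by (auto simp: Cauchy_convergent_iff convergent_def)
  have "l \<in> M" using closed_sequentially[OF assms(2) _ l] yM by blast
  moreover have "norm (x - l) = d"
    by (rule LIMSEQ_unique[OF _ lim]) (intro tendsto_intros l)
  ultimately show thesis using that d_le by metis
qed

text \<open>The nearest point works: a nonzero inner product with some \<open>z\<close> in
  \<open>M\<close> would allow a move along \<open>z\<close> that comes closer to
  \<open>x\<close>.\<close>

lemma subspace_orthogonal_decomp:
  fixes M :: "'a::{real_inner, complete_space} set"
  assumes "subspace M" and "closed M"
  obtains y where "y \<in> M" and "\<And>z. z \<in> M \<Longrightarrow> inner (x - y) z = 0"
proof -
  obtain y where y: "y \<in> M" and min: "\<And>z. z \<in> M \<Longrightarrow> norm (x - y) \<le> norm (x - z)"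
    using subspace_nearest_point[OF assms] by blast
  have "inner (x - y) z = 0" if z: "z \<in> M" for z
  proof (cases "z = 0")
    case False
    \<comment> \<open>This \<open>t\<close> minimizes the quadratic
      \<open>norm (x - (y + t *\<^sub>R z))\<close> squared.\<close>
    define t where "t = inner (x - y) z / inner z z"
    have nz: "inner z z \<noteq> 0" using False by simp
    have "(norm (x - y))\<^sup>2 \<le> (norm (x - (y + t *\<^sub>R z)))\<^sup>2"
      by (intro power_mono min subspace_add subspace_scale assms y z) simp
    also have "\<dots> = (norm (x - y))\<^sup>2 - 2 * t * inner (x - y) z + t * t * inner z z"
      by (simp add: power2_norm_eq_inner inner_diff_left inner_diff_right inner_add_left
          inner_add_right inner_commute algebra_simps)
    also have "\<dots> = (norm (x - y))\<^sup>2 - (inner (x - y) z)\<^sup>2 / inner z z"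
      using nz by (simp add: t_def power2_eq_square)
    finally have "(inner (x - y) z)\<^sup>2 / inner z z \<le> 0" by simp
    moreover have "inner z z > 0" using False by simp
    ultimately show ?thesis by (simp add: divide_le_0_iff)
  qed simp
  then show thesis using that y by blast
qed

text \<open>The predicate \<open>subspace\<close> only speaks of real scalars, so stability under
  complex ones is a separate assumption.\<close>

locale closed_csubspace =
  fixes M :: "'a::chilbert_space set"
  assumes subspace: "subspace M" and closed: "closed M"
    and scaleC: "x \<in> M \<Longrightarrow> a *\<^sub>C x \<in> M"
begin

text \<open>The difference of two candidates lies in \<open>M\<close> and is orthogonal to
  \<open>M\<close>, hence to itself.\<close>

lemma orth_proj_unique:
  assumes "y \<in> M" "\<And>z. z \<in> M \<Longrightarrow> cinner (x - y) z = 0"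
    and "y' \<in> M" "\<And>z. z \<in> M \<Longrightarrow> cinner (x - y') z = 0"
  shows "y = y'"
proof -
  have "y - y' \<in> M" using assms subspace by (simp add: subspace_diff)
  then have "cinner (x - y') (y - y') - cinner (x - y) (y - y') = 0"
    using assms by simp
  then have "cinner (y - y') (y - y') = 0"
    by (simp add: cinner_diff_left)
  then show ?thesis by (simp add: cinner_self_eq_0_iff)
qed

lemma orth_proj: "orth_proj M x \<in> M" "z \<in> M \<Longrightarrow> cinner (x - orth_proj M x) z = 0"
proof -
  obtain y where y: "y \<in> M" "\<And>z. z \<in> M \<Longrightarrow> inner (x - y) z = 0"
    using subspace_orthogonal_decomp[OF subspace closed] by blast
  \<comment> \<open>Real orthogonality to both \<open>z\<close> and \<open>\<i> *\<^sub>C z\<close>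
    kills the real and the imaginary part.\<close>
  have orth: "cinner (x - y) z = 0" if "z \<in> M" for z
    using y(2)[OF that] y(2)[OF scaleC[OF that]] by (simp add: cinner_eq_inner Complex_eq_0)
  have "y \<in> M \<and> (\<forall>z\<in>M. cinner (x - y) z = 0)"
    using y(1) orth by blast
  moreover have "y' = y" if "y' \<in> M \<and> (\<forall>z\<in>M. cinner (x - y') z = 0)" for y'
    using that orth_proj_unique[OF _ _ y(1) orth] by blast
  ultimately have "orth_proj M x \<in> M \<and> (\<forall>z\<in>M. cinner (x - orth_proj M x) z = 0)"
    unfolding orth_proj_def by (rule theI)
  then show "orth_proj M x \<in> M" "z \<in> M \<Longrightarrow> cinner (x - orth_proj M x) z = 0"
    by auto
qed

lemma orth_proj_eqI:
  "y \<in> M \<Longrightarrow> (\<And>z. z \<in> M \<Longrightarrow> cinner (x - y) z = 0) \<Longrightarrow> orth_proj M x = y"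
  by (rule orth_proj_unique[OF orth_proj])

text \<open>Linearity follows from uniqueness, since sums and multiples of projections have the
  characterizing property. The bound 1 is Cauchy-Schwarz applied to \<open>x\<close> and its
  projection.\<close>

lemma bounded_clinear_orth_proj: "bounded_clinear (orth_proj M)"
proof (rule bounded_clinearI[where K = 1])
  show "orth_proj M (x + y) = orth_proj M x + orth_proj M y" for x y
  proof (rule orth_proj_eqI)
    fix z assume "z \<in> M"
    then have "cinner ((x - orth_proj M x) + (y - orth_proj M y)) z = 0"
      by (simp add: cinner_add_left orth_proj(2))
    then show "cinner (x + y - (orth_proj M x + orth_proj M y)) z = 0"
      by (simp add: algebra_simps)
  qed (intro subspace_add subspace orth_proj(1))
  show "orth_proj M (a *\<^sub>C x) = a *\<^sub>C orth_proj M x" for a x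
  proof (rule orth_proj_eqI)
    fix z assume "z \<in> M"
    then have "a * cinner (x - orth_proj M x) z = 0"
      by (simp add: orth_proj(2))
    then show "cinner (a *\<^sub>C x - a *\<^sub>C orth_proj M x) z = 0"
      by (simp add: cinner_diff_left cinner_scaleC_left algebra_simps)
  qed (intro scaleC orth_proj(1))
  show "norm (orth_proj M x) \<le> norm x * 1" for x
  proof -
    have "inner (x - orth_proj M x) (orth_proj M x) = 0"
      by (simp add: inner_eq_Re_cinner orth_proj)
    then have "norm (orth_proj M x) * norm (orth_proj M x) = inner x (orth_proj M x)"
      by (simp add: inner_diff_left dot_square_norm power2_eq_square)
    also have "\<dots> \<le> norm x * norm (orth_proj M x)" by (rule norm_cauchy_schwarz)
    finally show ?thesis
      by (cases "orth_proj M x = 0") simp_all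
  qed
qed

end

section \<open>Ranges and kernels of positive operators\<close>

lemma subspace_closure:
  fixes S :: "'a::real_normed_vector set"
  assumes "subspace S" shows "subspace (closure S)"
  unfolding subspace_def
proof (intro conjI ballI allI)
  show "0 \<in> closure S"
    using closure_subset subspace_0[OF assms] by blast
  fix x c assume "x \<in> closure S"
  then obtain f where f: "\<And>n. f n \<in> S" "f \<longlonglongrightarrow> x" by (auto simp: closure_sequential)
  show "c *\<^sub>R x \<in> closure S"
    unfolding closure_sequential
    by (rule exI[of _ "\<lambda>n. c *\<^sub>R f n"])
      (simp add: f subspace_scale[OF assms] tendsto_scaleR)
  fix y assume "y \<in> closure S"
  then obtain g where g: "\<And>n. g n \<in> S" "g \<longlonglongrightarrow> y" by (auto simp: closure_sequential)
  show "x + y \<in> closure S"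
    unfolding closure_sequential
    by (rule exI[of _ "\<lambda>n. f n + g n"])
      (simp add: f g subspace_add[OF assms] tendsto_add)
qed

text \<open>Multiplication by a complex scalar is continuous and maps the range into itself, so it
  also preserves the closure.\<close>

lemma closed_csubspace_closure_range:
  fixes A :: "'a::complex_inner \<Rightarrow> 'b::chilbert_space"
  assumes "bounded_clinear A"
  shows "closed_csubspace (closure (range A))"
proof
  have "linear A" using assms by (simp add: bounded_clinear_def bounded_linear.linear)
  then show "subspace (closure (range A))"
    by (intro subspace_closure) (simp add: linear_subspace_image)
  fix x a assume "x \<in> closure (range A)"
  moreover have "(\<lambda>y. a *\<^sub>C y) ` range A \<subseteq> range A"
    by (auto simp: simp flip: bounded_clinear_scaleC[OF assms])
  then have "(\<lambda>y. a *\<^sub>C y) ` closure (range A) \<subseteq> closure (range A)"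
    by (metis closure_bounded_linear_image_subset bounded_linear_scaleC closure_mono order_trans)
  ultimately show "a *\<^sub>C x \<in> closure (range A)" by blast
qed simp

text \<open>The kernel of a self-adjoint operator is the orthogonal complement of its range;
  continuity of the inner product extends orthogonality to the closure.\<close>

lemma positive_op_eq_0_iff_orthogonal:
  assumes "bounded_clinear A" and "positive_op A"
  shows "A x = 0 \<longleftrightarrow> (\<forall>z\<in>closure (range A). cinner x z = 0)"
proof
  assume "A x = 0"
  then have "cinner z x = 0" if "z \<in> range A" for z
    using that by (auto simp: positive_op_self_adjoint[OF assms])
  then have "range A \<subseteq> {z. cinner z x = 0}" by blast
  moreover have "closed {z. cinner z x = 0}"
    by (intro closed_Collect_eq continuous_on_const linear_continuous_on bounded_linear_cinner_left)
  ultimately have le: "closure (range A) \<subseteq> {z. cinner z x = 0}"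
    by (rule closure_minimal)
  have "cinner x z = 0" if "z \<in> closure (range A)" for z
    using subsetD[OF le that] by (subst cinner_commute) simp
  then show "\<forall>z\<in>closure (range A). cinner x z = 0" by blast
next
  assume orth: "\<forall>z\<in>closure (range A). cinner x z = 0"
  \<comment> \<open>Testing against \<open>A (A x)\<close> and moving one \<open>A\<close> across
    gives the squared norm of \<open>A x\<close>.\<close>
  have "A (A x) \<in> closure (range A)" by (intro subsetD[OF closure_subset] rangeI)
  then have "cinner (A x) (A x) = 0"
    using orth by (simp add: positive_op_self_adjoint[OF assms])
  then show "A x = 0" by (simp add: cinner_self_eq_0_iff)
qed

text \<open>The part of \<open>x\<close> removed by the projection is orthogonal to the range, hence
  in the kernel of \<open>A\<close>.\<close>

lemma positive_op_range_proj:
  fixes A :: "'a::chilbert_space \<Rightarrow> 'a"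
  assumes "bounded_clinear A" and "positive_op A"
  shows "A (range_proj A x) = A x"
proof -
  have "A (x - range_proj A x) = 0"
    using closed_csubspace.orth_proj(2)[OF closed_csubspace_closure_range[OF assms(1)]]
    by (simp add: positive_op_eq_0_iff_orthogonal[OF assms])
  then show ?thesis
    using assms(1) by (simp add: bounded_clinear_def linear_diff bounded_linear.linear)
qed

text \<open>Two points with the same image differ by a vector of the closed range that is also
  orthogonal to it.\<close>

lemma positive_op_inj_on_closure_range:
  fixes A :: "'a::chilbert_space \<Rightarrow> 'a"
  assumes "bounded_clinear A" and "positive_op A"
  shows "inj_on A (closure (range A))"
proof (rule inj_onI)
  fix x y assume xy: "x \<in> closure (range A)" "y \<in> closure (range A)" and "A x = A y"
  then have "A (x - y) = 0"
    using assms(1) by (simp add: bounded_clinear_def linear_diff bounded_linear.linear)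
  moreover have "x - y \<in> closure (range A)"
    using xy closed_csubspace.subspace[OF closed_csubspace_closure_range[OF assms(1)]]
    by (simp add: subspace_diff)
  ultimately have "cinner (x - y) (x - y) = 0"
    by (simp add: positive_op_eq_0_iff_orthogonal[OF assms])
  then show "x = y" by (simp add: cinner_self_eq_0_iff)
qed


section \<open>Reduced weighted adjoints of bounded operators\<close>

lemma total_op_comp: "total_op f \<circ>\<^sub>m total_op g = total_op (f \<circ> g)"
  by (simp add: total_op_def map_comp_def comp_def)

lemma linear_op_total_op: "bounded_clinear f \<Longrightarrow> linear_op (total_op f)"
  by (simp add: linear_op_def total_op_def bounded_clinear_def linear_add linear_0
      bounded_linear.linear)

text \<open>For an everywhere defined \<open>T\<close> the test vectors exhaust the space, so
  \<open>G y\<close> is the only admissible vector for each \<open>y\<close>.\<close>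

lemma adjoint_op_total_op:
  assumes "\<And>x y. cinner (T x) y = cinner x (G y)"
  shows "adjoint_op (total_op T) = total_op G"
proof
  fix y
  have "(\<forall>x. cinner (T x) y = cinner x z) \<longleftrightarrow> z = G y" for z
    unfolding assms by (auto intro: cinner_eqI[symmetric])
  then show "adjoint_op (total_op T) y = total_op G y"
    by (simp add: adjoint_op_def total_op_def dom_def)
qed

text \<open>By \<open>factor\<close>, \<open>R\<close> solves the defining equation up to the range
  condition. Projecting \<open>R\<close> leaves \<open>V (R y)\<close> unchanged and enforces that
  condition; injectivity of \<open>V\<close> on the closure of its range excludes any other
  solution.\<close>

lemma is_reduced_adjoint_total_op_iff:
  fixes V :: "'a::chilbert_space \<Rightarrow> 'a"
  assumes V: "bounded_clinear V" "positive_op V"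
    and T: "bounded_clinear T" and R: "bounded_clinear R"
    and adj: "\<And>x y. cinner (T x) y = cinner x (G y)"
    and factor: "\<And>y. G (W y) = V (R y)"
  shows "is_reduced_adjoint V W (total_op T) X \<longleftrightarrow> X = total_op (range_proj V \<circ> R)"
proof
  interpret closed_csubspace "closure (range V)"
    by (rule closed_csubspace_closure_range[OF V(1)])
  have lhs: "adjoint_op (total_op T) \<circ>\<^sub>m total_op W = total_op (\<lambda>y. V (R y))"
    by (simp add: adjoint_op_total_op[OF adj] total_op_comp comp_def factor)
  have T': "linear_op (total_op T)" "dom (total_op T) = UNIV"
    by (simp_all add: linear_op_total_op T) (simp add: total_op_def dom_def)
  {
    assume X: "X = total_op (range_proj V \<circ> R)"
    have "ran X \<subseteq> closure (range V)"
      by (auto simp: X ran_def total_op_def orth_proj(1))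
    moreover have "linear_op X"
      unfolding X
      by (intro linear_op_total_op bounded_clinear_compose bounded_clinear_orth_proj R)
    moreover have "total_op V \<circ>\<^sub>m X = total_op (\<lambda>y. V (R y))"
      by (simp add: X total_op_comp comp_def positive_op_range_proj[OF V])
    ultimately show "is_reduced_adjoint V W (total_op T) X"
      by (simp add: is_reduced_adjoint_def lhs T')
  }
  assume "is_reduced_adjoint V W (total_op T) X"
  then have eq: "total_op (\<lambda>y. V (R y)) = total_op V \<circ>\<^sub>m X"
    and ran: "ran X \<subseteq> closure (range V)"
    by (simp_all add: is_reduced_adjoint_def lhs)
  show "X = total_op (range_proj V \<circ> R)"
  proof
    fix y
    \<comment> \<open>The left side of \<open>eq\<close> is defined everywhere, which forces
      \<open>X\<close> to be defined at \<open>y\<close>.\<close>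
    from fun_cong[OF eq, of y] obtain u where u: "X y = Some u" "V u = V (R y)"
      by (auto simp: total_op_def map_comp_def split: option.splits)
    have "u \<in> closure (range V)" using ran u(1) by (auto simp: ran_def)
    moreover have "V u = V (range_proj V (R y))"
      by (simp add: u positive_op_range_proj[OF V])
    ultimately have "u = range_proj V (R y)"
      using positive_op_inj_on_closure_range[OF V] orth_proj(1) by (auto dest: inj_onD)
    then show "X y = total_op (range_proj V \<circ> R) y" by (simp add: u total_op_def)
  qed
qed

lemma reduced_adjoint_total_op:
  fixes V :: "'a::chilbert_space \<Rightarrow> 'a"
  assumes V: "bounded_clinear V" "positive_op V"
    and T: "bounded_clinear T" and R: "bounded_clinear R"
    and "\<And>x y. cinner (T x) y = cinner x (G y)"
    and "\<And>y. G (W y) = V (R y)"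
  shows "\<exists>!X. is_reduced_adjoint V W (total_op T) X"
    and "reduced_adjoint V W (total_op T) = total_op (range_proj V) \<circ>\<^sub>m total_op R"
    and "bounded_op (reduced_adjoint V W (total_op T))"
proof -
  note iff = is_reduced_adjoint_total_op_iff[OF assms]
  show "\<exists>!X. is_reduced_adjoint V W (total_op T) X"
    unfolding iff by blast
  show eq: "reduced_adjoint V W (total_op T) = total_op (range_proj V) \<circ>\<^sub>m total_op R"
    unfolding reduced_adjoint_def iff by (simp add: total_op_comp)
  have "bounded_clinear (range_proj V \<circ> R)"
    by (intro bounded_clinear_compose R closed_csubspace.bounded_clinear_orth_proj
        closed_csubspace_closure_range V)
  then show "bounded_op (reduced_adjoint V W (total_op T))"
    unfolding eq total_op_comp bounded_op_def by blast
qed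


section \<open>Analysis and synthesis operators of a Bessel sequence\<close>

text \<open>A total function, so that composition and adjoint identities avoid partiality.
  \<open>Abs_ell2\<close> is meaningful here once \<open>F\<close> is Bessel.\<close>

definition analysis_op :: "(nat \<Rightarrow> 'h::complex_inner) \<Rightarrow> 'h \<Rightarrow> ell2" where
  "analysis_op F f = Abs_ell2 (\<lambda>n. cinner f (F n))"

definition synthesis_op :: "(nat \<Rightarrow> 'h::complex_inner) \<Rightarrow> ell2 \<Rightarrow> 'h" where
  "synthesis_op F c = (\<Sum>n. Rep_ell2 c n *\<^sub>C F n)"

lemma bessel_square_summable: "bessel F \<Longrightarrow> square_summable (\<lambda>n. cinner f (F n))"
  by (auto simp: bessel_def square_summable_def)

lemma Rep_analysis_op: "bessel F \<Longrightarrow> Rep_ell2 (analysis_op F f) = (\<lambda>n. cinner f (F n))"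
  by (simp add: analysis_op_def Abs_ell2_inverse bessel_square_summable)

lemma bounded_clinear_analysis_op:
  assumes "bessel F" shows "bounded_clinear (analysis_op F)"
proof -
  obtain b where b: "b > 0" "\<And>f. (\<Sum>n. (cmod (cinner f (F n)))\<^sup>2) \<le> b * (norm f)\<^sup>2"
    using assms by (auto simp: bessel_def)
  show ?thesis
  proof (rule bounded_clinearI)
    show "norm (analysis_op F f) \<le> norm f * sqrt b" for f
    proof (rule power2_le_imp_le)
      show "(norm (analysis_op F f))\<^sup>2 \<le> (norm f * sqrt b)\<^sup>2"
        using b by (simp add: norm_ell2_sq Rep_analysis_op[OF assms] power_mult_distrib mult.commute)
    qed (use b in simp)
  qed (simp_all add: Rep_ell2_inject[symmetric] plus_ell2.rep_eq scaleC_ell2.rep_eq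
      Rep_analysis_op[OF assms] cinner_add_left cinner_scaleC_left)
qed

text \<open>Duality: pairing the sum \<open>w\<close> with itself, Cauchy-Schwarz and the Bessel
  bound at \<open>w\<close> give a factor \<open>norm w\<close> that cancels. Arbitrary finite
  \<open>I\<close> covers both initial segments and the blocks needed for the Cauchy
  criterion.\<close>

lemma norm_sum_scaleC_le:
  assumes b: "b > 0" and sm: "\<And>f. summable (\<lambda>n. (cmod (cinner f (F n)))\<^sup>2)"
    and le: "\<And>f. (\<Sum>n. (cmod (cinner f (F n)))\<^sup>2) \<le> b * (norm f)\<^sup>2"
    and "finite I"
  shows "(norm (\<Sum>n\<in>I. c n *\<^sub>C F n))\<^sup>2 \<le> b * (\<Sum>n\<in>I. (cmod (c n))\<^sup>2)"
proof -
  define w where "w = (\<Sum>n\<in>I. c n *\<^sub>C F n)"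
  \<comment> \<open>Only the first copy of \<open>w\<close> is expanded; the second remains as the
    vector for the Bessel bound.\<close>
  have "(norm w)\<^sup>2 = (\<Sum>n\<in>I. Re (c n * cinner (F n) w))"
    unfolding power2_norm_eq_inner
    by (subst (1) w_def) (simp only: inner_sum_left inner_eq_Re_cinner[of "_ *\<^sub>C _"] cinner_scaleC_left)
  also have "\<dots> \<le> (\<Sum>n\<in>I. \<bar>cmod (c n)\<bar> * \<bar>cmod (cinner w (F n))\<bar>)"
  proof (rule sum_mono)
    show "Re (c n * cinner (F n) w) \<le> \<bar>cmod (c n)\<bar> * \<bar>cmod (cinner w (F n))\<bar>" for n
      using complex_Re_le_cmod[of "c n * cinner (F n) w"]
      by (simp add: norm_mult cinner_commute[of w])
  qed
  also have "\<dots> \<le> L2_set (\<lambda>n. cmod (c n)) I * L2_set (\<lambda>n. cmod (cinner w (F n))) I"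
    by (rule L2_set_mult_ineq)
  also have "\<dots> \<le> L2_set (\<lambda>n. cmod (c n)) I * (sqrt b * norm w)"
  proof (rule mult_left_mono)
    have "(\<Sum>n\<in>I. (cmod (cinner w (F n)))\<^sup>2) \<le> b * (norm w)\<^sup>2"
      using sum_le_suminf[OF sm \<open>finite I\<close>, of w] le[of w] by simp
    then show "L2_set (\<lambda>n. cmod (cinner w (F n))) I \<le> sqrt b * norm w"
      unfolding L2_set_def by (simp add: real_le_lsqrt real_sqrt_mult power_mult_distrib sum_nonneg b less_imp_le)
  qed simp
  finally have "norm w * norm w \<le> (L2_set (\<lambda>n. cmod (c n)) I * sqrt b) * norm w"
    by (simp add: power2_eq_square mult_ac)
  then have "norm w \<le> L2_set (\<lambda>n. cmod (c n)) I * sqrt b"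
    using b by (cases "w = 0") (simp_all add: mult_le_cancel_right)
  then have "(norm w)\<^sup>2 \<le> (L2_set (\<lambda>n. cmod (c n)) I * sqrt b)\<^sup>2"
    by (intro power_mono) auto
  then show ?thesis
    using b by (simp add: w_def L2_set_def power_mult_distrib sum_nonneg mult.commute)
qed

lemma sum_lessThan_diff:
  fixes g :: "nat \<Rightarrow> 'a::ab_group_add"
  shows "k \<le> m \<Longrightarrow> (\<Sum>n<m. g n) - (\<Sum>n<k. g n) = (\<Sum>n\<in>{k..<m}. g n)"
  using sum_diff_nat_ivl[of 0 k m g] by (simp add: atLeast0LessThan)

text \<open>Blocks of the vector series are dominated by \<open>b\<close> times blocks of the
  convergent series of squared coefficients, so the partial sums are Cauchy.\<close>

lemma summable_synthesis:
  fixes F :: "nat \<Rightarrow> 'h::chilbert_space"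
  assumes "bessel F" and "square_summable c"
  shows "summable (\<lambda>n. c n *\<^sub>C F n)"
proof -
  obtain b where b: "b > 0" "\<And>f. summable (\<lambda>n. (cmod (cinner f (F n)))\<^sup>2)"
      "\<And>f. (\<Sum>n. (cmod (cinner f (F n)))\<^sup>2) \<le> b * (norm f)\<^sup>2"
    using assms(1) by (auto simp: bessel_def)
  have "Cauchy (\<lambda>N. \<Sum>n<N. c n *\<^sub>C F n)"
  proof (rule metric_CauchyI)
    fix e :: real assume e: "e > 0"
    have "Cauchy (\<lambda>N. \<Sum>n<N. (cmod (c n))\<^sup>2)"
      using assms(2) by (simp add: square_summable_def summable_iff_convergent convergent_Cauchy)
    then obtain M where M: "\<And>k m. k \<ge> M \<Longrightarrow> m \<ge> M \<Longrightarrow>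
        dist (\<Sum>n<k. (cmod (c n))\<^sup>2) (\<Sum>n<m. (cmod (c n))\<^sup>2) < e\<^sup>2 / b"
      using metric_CauchyD[of _ "e\<^sup>2 / b"] e b(1) by (metis divide_pos_pos zero_less_power)
    have le: "dist (\<Sum>n<k. c n *\<^sub>C F n) (\<Sum>n<m. c n *\<^sub>C F n) < e" if "M \<le> k" "k \<le> m" for k m
    proof -
      note diff = sum_lessThan_diff[OF that(2)]
      have "(norm (\<Sum>n\<in>{k..<m}. c n *\<^sub>C F n))\<^sup>2 \<le> b * (\<Sum>n\<in>{k..<m}. (cmod (c n))\<^sup>2)"
        by (intro norm_sum_scaleC_le b) simp
      also have "\<dots> < b * (e\<^sup>2 / b)"
        using M[of m k] that b(1) by (intro mult_strict_left_mono) (auto simp: dist_real_def diff)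
      finally have "(norm (\<Sum>n\<in>{k..<m}. c n *\<^sub>C F n))\<^sup>2 < e\<^sup>2" using b(1) by simp
      then have "norm (\<Sum>n\<in>{k..<m}. c n *\<^sub>C F n) < e"
        using e by (simp add: power2_less_imp_less)
      then show ?thesis
        by (subst dist_commute) (simp add: dist_norm diff)
    qed
    then show "\<exists>M. \<forall>k\<ge>M. \<forall>m\<ge>M. dist (\<Sum>n<k. c n *\<^sub>C F n) (\<Sum>n<m. c n *\<^sub>C F n) < e"
      by (metis dist_commute nat_le_linear)
  qed
  then show ?thesis by (simp add: summable_iff_convergent Cauchy_convergent)
qed

lemma summable_Rep_ell2:
  fixes F :: "nat \<Rightarrow> 'h::chilbert_space"
  shows "bessel F \<Longrightarrow> summable (\<lambda>n. Rep_ell2 c n *\<^sub>C F n)"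
  using Rep_ell2[of c] by (simp add: summable_synthesis)

text \<open>The bound for finite sums is uniform in their length and passes to the limit.\<close>

lemma bounded_clinear_synthesis_op:
  fixes F :: "nat \<Rightarrow> 'h::chilbert_space"
  assumes "bessel F" shows "bounded_clinear (synthesis_op F)"
proof -
  obtain b where b: "b > 0" "\<And>f. summable (\<lambda>n. (cmod (cinner f (F n)))\<^sup>2)"
      "\<And>f. (\<Sum>n. (cmod (cinner f (F n)))\<^sup>2) \<le> b * (norm f)\<^sup>2"
    using assms(1) by (auto simp: bessel_def)
  note sm = summable_Rep_ell2[OF assms]
  show ?thesis
  proof (rule bounded_clinearI)
    show "synthesis_op F (c + d) = synthesis_op F c + synthesis_op F d" for c d
      by (simp add: synthesis_op_def plus_ell2.rep_eq scaleC_add_left suminf_add sm)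
    show "synthesis_op F (a *\<^sub>C c) = a *\<^sub>C synthesis_op F c" for a c
      by (simp add: synthesis_op_def scaleC_ell2.rep_eq sm
          bounded_linear.suminf[OF bounded_linear_scaleC] flip: scaleC_scaleC)
    show "norm (synthesis_op F c) \<le> norm c * sqrt b" for c
    proof (rule power2_le_imp_le)
      have "(norm (synthesis_op F c))\<^sup>2 \<le> b * (norm c)\<^sup>2"
      proof (rule LIMSEQ_le_const2)
        show "(\<lambda>N. (norm (\<Sum>n<N. Rep_ell2 c n *\<^sub>C F n))\<^sup>2) \<longlonglongrightarrow> (norm (synthesis_op F c))\<^sup>2"
          unfolding synthesis_op_def by (intro tendsto_intros summable_LIMSEQ sm)
        have "(norm (\<Sum>n<N. Rep_ell2 c n *\<^sub>C F n))\<^sup>2 \<le> b * (norm c)\<^sup>2" for N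
          by (rule order_trans[OF norm_sum_scaleC_le[OF b] mult_left_mono[OF sum_le_norm_ell2_sq]])
            (simp_all add: b(1) less_imp_le)
        then show "\<exists>N. \<forall>n\<ge>N. (norm (\<Sum>n<n. Rep_ell2 c n *\<^sub>C F n))\<^sup>2 \<le> b * (norm c)\<^sup>2"
          by blast
      qed
      then show "(norm (synthesis_op F c))\<^sup>2 \<le> (norm c * sqrt b)\<^sup>2"
        using b(1) by (simp add: power_mult_distrib mult.commute)
    qed (use b in simp)
  qed
qed

text \<open>Continuity of the inner product in its first argument moves it inside the
  series.\<close>

lemma cinner_synthesis_op:
  fixes F :: "nat \<Rightarrow> 'h::chilbert_space"
  assumes "bessel F"
  shows "cinner (synthesis_op F c) f = cinner c (analysis_op F f)"
proof -
  have "cinner (synthesis_op F c) f = (\<Sum>n. cinner (Rep_ell2 c n *\<^sub>C F n) f)"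
    unfolding synthesis_op_def
    by (rule bounded_linear.suminf[OF bounded_linear_cinner_left summable_Rep_ell2[OF assms]])
  also have "\<dots> = (\<Sum>n. Rep_ell2 c n * cnj (cinner f (F n)))"
    by (simp add: cinner_scaleC_left flip: cinner_commute)
  also have "\<dots> = cinner c (analysis_op F f)"
    by (simp add: cinner_ell2.rep_eq Rep_analysis_op[OF assms])
  finally show ?thesis .
qed

lemma cinner_analysis_op:
  fixes F :: "nat \<Rightarrow> 'h::chilbert_space"
  shows "bessel F \<Longrightarrow> cinner (analysis_op F f) c = cinner f (synthesis_op F c)"
  by (subst (1 2) cinner_commute) (simp add: cinner_synthesis_op)

text \<open>The Bessel condition makes the domain test succeed at every vector.\<close>

lemma C_AB_eq: "bessel F \<Longrightarrow> C_AB A F = total_op (analysis_op F \<circ> A)"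
  by (simp add: C_AB_def total_op_def weighted_cinner_def bessel_square_summable analysis_op_def)

lemma D_AB_eq:
  fixes F :: "nat \<Rightarrow> 'h::chilbert_space"
  shows "bessel F \<Longrightarrow> D_AB B F = total_op (synthesis_op F \<circ> B)"
  by (simp add: D_AB_def D_F_def total_op_def map_comp_def summable_Rep_ell2 synthesis_op_def comp_def)

theorem proposition4p15:
  fixes A :: "'h::chilbert_space \<Rightarrow> 'h"
    and B :: "ell2 \<Rightarrow> ell2"
    and F :: "nat \<Rightarrow> 'h"
  assumes "bounded_clinear A" and "positive_op A"
    and "bounded_clinear B" and "positive_op B"
    and "bessel F"
  shows "(\<exists>!X. is_reduced_adjoint A B (C_AB A F) X) \<and>
         (\<exists>!X. is_reduced_adjoint B A (D_AB B F) X) \<and>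
         (\<exists>!X. is_reduced_adjoint A A (S_AB A B F) X) \<and>
         bounded_op (reduced_adjoint A B (C_AB A F)) \<and>
         bounded_op (reduced_adjoint B A (D_AB B F)) \<and>
         bounded_op (reduced_adjoint A A (S_AB A B F)) \<and>
         reduced_adjoint A B (C_AB A F) = total_op (range_proj A) \<circ>\<^sub>m D_AB B F \<and>
         reduced_adjoint B A (D_AB B F) = total_op (range_proj B) \<circ>\<^sub>m C_AB A F \<and>
         reduced_adjoint A A (S_AB A B F) = total_op (range_proj A) \<circ>\<^sub>m S_AB A B F"
proof -
  let ?C = "analysis_op F" and ?D = "synthesis_op F"
  note A = assms(1,2) and B = assms(3,4) and F = assms(5)
  note adj = positive_op_self_adjoint[OF A] positive_op_self_adjoint[OF B]
    cinner_analysis_op[OF F] cinner_synthesis_op[OF F]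
  have bl: "bounded_clinear (?C \<circ> A)" "bounded_clinear (?D \<circ> B)"
      "bounded_clinear ((?D \<circ> B) \<circ> (?C \<circ> A))"
    by (intro bounded_clinear_compose bounded_clinear_analysis_op bounded_clinear_synthesis_op
        A B F)+
  have S: "S_AB A B F = total_op ((?D \<circ> B) \<circ> (?C \<circ> A))"
    by (simp only: S_AB_def C_AB_eq[OF F] D_AB_eq[OF F] total_op_comp)
  \<comment> \<open>The adjoint of \<open>?C \<circ> A\<close> is \<open>A \<circ> ?D\<close>;
    following \<open>B\<close> it factors as \<open>A\<close> after
    \<open>?D \<circ> B\<close>.\<close>
  note C = reduced_adjoint_total_op[OF A bl(1) bl(2), where G = "A \<circ> ?D" and W = B,
      folded C_AB_eq[OF F] D_AB_eq[OF F]]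
  \<comment> \<open>The same with the roles exchanged: the adjoint of \<open>?D \<circ> B\<close> is
    \<open>B \<circ> ?C\<close>, and following \<open>A\<close> it is \<open>B\<close> after
    \<open>?C \<circ> A\<close>.\<close>
  note D = reduced_adjoint_total_op[OF B bl(2) bl(1), where G = "B \<circ> ?C" and W = A,
      folded C_AB_eq[OF F] D_AB_eq[OF F]]
  \<comment> \<open>Here \<open>T\<close> and \<open>R\<close> coincide: the adjoint following
    \<open>A\<close> is the palindrome \<open>A\<close>, \<open>?D\<close>, \<open>B\<close>,
    \<open>?C\<close>, \<open>A\<close>, that is, \<open>A\<close> after the operator
    itself.\<close>
  note S = reduced_adjoint_total_op[OF A bl(3) bl(3), where G = "A \<circ> ?D \<circ> B \<circ> ?C" and W = A,
      folded S]
  show ?thesis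
    by (intro conjI C D S) (simp_all add: adj)
qed

end
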